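(* For every $x\in\Omega=C_0([0,T];\mathbb R)$ and every continuous finite-variation path $h:[0,T]\to\mathbb R$ with $h_0=0$, the bracket functional $Q$ defined in the context satisfies $$Q(x+h)=Q(x).$$
   Context: Fix $T,\Lambda>0$. $\Omega=C_0([0,T];\mathbb R)$ is the space of continuous real paths on $[0,T]$ starting at $0$. With $t_k^n=kT2^{-n}$, $0\le k\le2^n$, put $V^n_t(x)=\sum_{k:\,t^n_{k+1}\le t}(x_{t^n_{k+1}}-x_{t^n_k})^2$. For a nonnegative increasing function $a$ on $[0,T]$ with $a_0=0$ put $(\mathcal R_\Lambda a)_t=\inf_{0\le u\le t}\{a_u+\Lambda(t-u)\}$. Define $q^n(x)=\mathcal R_\Lambda V^n(x)$ and $Q_t(x)=\limsup_{n\to\infty}q^n_t(x)$ for every $x\in\Omega$ and $t\in[0,T]$. *)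

theory Defs
  imports "HOL-Analysis.Analysis"
begin

text \<open>Paths on \<open>[0,T]\<close> are represented by functions \<open>real \<Rightarrow> real\<close>; their values
  outside \<open>[0,T]\<close> are irrelevant, since nothing below evaluates a path there.\<close>

definition path_space :: "real \<Rightarrow> (real \<Rightarrow> real) set" where
  "path_space T = {x. continuous_on {0..T} x \<and> x 0 = 0}"

definition finite_variation_on :: "real \<Rightarrow> real \<Rightarrow> (real \<Rightarrow> real) \<Rightarrow> bool" where
  "finite_variation_on a b h \<longleftrightarrow>
     bdd_above {\<Sum>i<m. \<bar>h (s (Suc i)) - h (s i)\<bar> | m s.
       s 0 = a \<and> s m = b \<and> mono_on {..m} s}"

definition dyadic :: "real \<Rightarrow> nat \<Rightarrow> nat \<Rightarrow> real" where
  "dyadic T n k = real k * T / 2 ^ n"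

definition dyadic_variation :: "real \<Rightarrow> nat \<Rightarrow> (real \<Rightarrow> real) \<Rightarrow> real \<Rightarrow> real" where
  "dyadic_variation T n x t =
     (\<Sum>k | k < 2 ^ n \<and> dyadic T n (Suc k) \<le> t.
        (x (dyadic T n (Suc k)) - x (dyadic T n k))\<^sup>2)"

text \<open>The infimum is the conditionally complete one of \<open>real\<close>. It is the genuine infimum for
  nonnegative \<open>a\<close> and \<open>t \<ge> 0\<close>: the index set is then nonempty and the values are bounded
  below by \<open>0\<close>.\<close>

definition regularization :: "real \<Rightarrow> (real \<Rightarrow> real) \<Rightarrow> real \<Rightarrow> real" where
  "regularization \<Lambda> a t = (INF u\<in>{0..t}. a u + \<Lambda> * (t - u))"

definition approx_bracket :: "real \<Rightarrow> real \<Rightarrow> nat \<Rightarrow> (real \<Rightarrow> real) \<Rightarrow> real \<Rightarrow> real" where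
  "approx_bracket T \<Lambda> n x = regularization \<Lambda> (dyadic_variation T n x)"

text \<open>The limit superior is taken in the extended reals; \<open>bracket_bounds\<close> below shows that it
  is finite.\<close>

definition bracket :: "real \<Rightarrow> real \<Rightarrow> (real \<Rightarrow> real) \<Rightarrow> real \<Rightarrow> ereal" where
  "bracket T \<Lambda> x t = limsup (\<lambda>n. ereal (approx_bracket T \<Lambda> n x t))"

lemma dyadic_variation_nonneg: "0 \<le> dyadic_variation T n x t"
  unfolding dyadic_variation_def by (intro sum_nonneg) auto

lemma dyadic_variation_mono: "mono (dyadic_variation T n x)"
  unfolding dyadic_variation_def by (intro monoI sum_mono2) auto

lemma dyadic_variation_0:
  assumes "T > 0"
  shows "dyadic_variation T n x 0 = 0"
proof -
  have "\<not> dyadic T n (Suc k) \<le> 0" for k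
    using assms by (simp add: dyadic_def not_le)
  then show ?thesis by (simp add: dyadic_variation_def)
qed

lemma approx_bracket_bounds:
  assumes "T > 0" "\<Lambda> > 0" "t \<ge> 0"
  shows "0 \<le> approx_bracket T \<Lambda> n x t" "approx_bracket T \<Lambda> n x t \<le> \<Lambda> * t"
proof -
  let ?f = "\<lambda>u. dyadic_variation T n x u + \<Lambda> * (t - u)"
  have nonneg: "0 \<le> ?f u" if "u \<in> {0..t}" for u
    using that assms dyadic_variation_nonneg[of T n x u] by auto
  then have bdd: "bdd_below (?f ` {0..t})"
    by (intro bdd_belowI2)
  show "0 \<le> approx_bracket T \<Lambda> n x t"
    unfolding approx_bracket_def regularization_def
    using nonneg assms(3) by (intro cINF_greatest) auto
  have "approx_bracket T \<Lambda> n x t \<le> ?f 0"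
    unfolding approx_bracket_def regularization_def
    using bdd assms(3) by (intro cINF_lower) auto
  then show "approx_bracket T \<Lambda> n x t \<le> \<Lambda> * t"
    using dyadic_variation_0[OF assms(1)] by simp
qed

lemma bracket_bounds:
  assumes "T > 0" "\<Lambda> > 0" "t \<ge> 0"
  shows "0 \<le> bracket T \<Lambda> x t" "bracket T \<Lambda> x t \<le> ereal (\<Lambda> * t)"
proof -
  have "limsup (\<lambda>n. 0 :: ereal) \<le> bracket T \<Lambda> x t"
    unfolding bracket_def using approx_bracket_bounds[OF assms]
    by (intro Limsup_mono always_eventually) auto
  then show "0 \<le> bracket T \<Lambda> x t" by (simp add: Limsup_const)
  show "bracket T \<Lambda> x t \<le> ereal (\<Lambda> * t)"
    unfolding bracket_def using approx_bracket_bounds[OF assms]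
    by (intro Limsup_bounded always_eventually) auto
qed

end

theory Submission
  imports Defs
begin

text \<open>Perturbing \<open>x\<close> by \<open>h\<close> changes the squared increments by \<open>\<Delta>h (2 \<Delta>x + \<Delta>h)\<close>, whose sum is at
  most the total variation of \<open>h\<close> times the oscillation of \<open>2 x + h\<close> at the mesh size. So the
  dyadic variations of \<open>x + h\<close> and \<open>x\<close> differ by a uniformly vanishing amount, even if
  they diverge; the regularization is 1-Lipschitz in the supremum norm, which transfers this to
  \<open>q\<^sup>n\<close> and hence to the limit superior.\<close>

lemma dyadic_mem:
  assumes "T > 0" "k \<le> 2 ^ n"
  shows "dyadic T n k \<in> {0..T}"
proof -
  have "real k \<le> 2 ^ n"
    using assms(2) by (metis of_nat_le_iff of_nat_numeral of_nat_power)
  then show ?thesis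
    using assms(1) by (simp add: dyadic_def field_simps)
qed

text \<open>A continuous path on the compact interval is uniformly continuous, and the mesh
  \<open>T / 2 ^ n\<close> eventually drops below its modulus for \<open>e\<close>; hence one
  threshold for \<open>n\<close> serves all \<open>k\<close>.\<close>

lemma dyadic_increment_eventually_small:
  fixes g :: "real \<Rightarrow> real"
  assumes T: "T > 0" and g: "continuous_on {0..T} g" and e: "e > 0"
  shows "\<forall>\<^sub>F n in sequentially. \<forall>k<2^n. \<bar>g (dyadic T n (Suc k)) - g (dyadic T n k)\<bar> \<le> e"
proof -
  have "uniformly_continuous_on {0..T} g"
    using g by (intro compact_uniformly_continuous) auto
  then obtain d where d: "d > 0"
    "\<And>s t. s \<in> {0..T} \<Longrightarrow> t \<in> {0..T} \<Longrightarrow> dist t s < d \<Longrightarrow> dist (g t) (g s) < e"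
    using e by (rule uniformly_continuous_onE) blast
  have "(\<lambda>n. T / 2 ^ n) \<longlonglongrightarrow> 0"
    using tendsto_mult_right_zero[OF LIMSEQ_power_zero[of "1/2::real"], of T]
    by (simp add: power_one_over field_simps)
  then have "\<forall>\<^sub>F n in sequentially. T / 2 ^ n < d"
    using d(1) by (rule order_tendstoD)
  then show ?thesis
  proof eventually_elim
    case (elim n)
    show ?case
    proof (intro allI impI)
      fix k :: nat assume k: "k < 2 ^ n"
      have "dist (dyadic T n (Suc k)) (dyadic T n k) = T / 2 ^ n"
        using T by (simp add: dist_real_def dyadic_def field_simps)
      then have "dist (g (dyadic T n (Suc k))) (g (dyadic T n k)) < e"
        using d(2)[of "dyadic T n k" "dyadic T n (Suc k)"] elim k dyadic_mem[OF T] by simp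
      then show "\<bar>g (dyadic T n (Suc k)) - g (dyadic T n k)\<bar> \<le> e"
        by (simp add: dist_real_def)
    qed
  qed
qed

lemma finite_variation_on_dyadic_bound:
  assumes T: "T > 0" and h: "finite_variation_on 0 T h"
  obtains C where "C > 0"
    "\<And>n. (\<Sum>k<2^n. \<bar>h (dyadic T n (Suc k)) - h (dyadic T n k)\<bar>) \<le> C"
proof -
  obtain C where C: "\<And>v. v \<in> {\<Sum>i<m. \<bar>h (s (Suc i)) - h (s i)\<bar> | m s.
      s 0 = 0 \<and> s m = T \<and> mono_on {..m} s} \<Longrightarrow> v \<le> C"
    using h unfolding finite_variation_on_def bdd_above_def by (elim exE) (rule that, erule bspec)
  have "(\<Sum>k<2^n. \<bar>h (dyadic T n (Suc k)) - h (dyadic T n k)\<bar>) \<le> C" for n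
  proof (rule C, intro CollectI exI conjI)
    show "dyadic T n 0 = 0" "dyadic T n (2 ^ n) = T"
      by (simp_all add: dyadic_def)
    show "mono_on {..2 ^ n} (dyadic T n)"
      using T by (intro mono_onI) (simp add: dyadic_def divide_right_mono)
  qed (rule refl)
  \<comment> \<open>Passing to \<open>max C 1\<close> makes the bound strictly positive, so that it
    can later serve as a divisor.\<close>
  then show thesis
    by (intro that[of "max C 1"]) (auto intro: max.coboundedI1)
qed

text \<open>With increments \<open>X\<close> and \<open>H\<close>, the difference of squares factors
  as \<open>H * (2 * X + H)\<close>. The second factor is at most \<open>2 * e + e\<close>, and the
  first is summed in absolute value.\<close>

lemma dyadic_variation_diff_le:
  assumes "\<And>k. k < 2 ^ n \<Longrightarrow> \<bar>x (dyadic T n (Suc k)) - x (dyadic T n k)\<bar> \<le> e"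
    and "\<And>k. k < 2 ^ n \<Longrightarrow> \<bar>h (dyadic T n (Suc k)) - h (dyadic T n k)\<bar> \<le> e"
  shows "\<bar>dyadic_variation T n (\<lambda>s. x s + h s) u - dyadic_variation T n x u\<bar>
    \<le> 3 * e * (\<Sum>k<2^n. \<bar>h (dyadic T n (Suc k)) - h (dyadic T n k)\<bar>)"
proof -
  define K where "K = {k. k < 2 ^ n \<and> dyadic T n (Suc k) \<le> u}"
  define X H where "X k = x (dyadic T n (Suc k)) - x (dyadic T n k)"
    and "H k = h (dyadic T n (Suc k)) - h (dyadic T n k)" for k
  have K: "K \<subseteq> {..<2^n}"
    by (auto simp: K_def)
  have term_le: "\<bar>H k * (2 * X k + H k)\<bar> \<le> 3 * e * \<bar>H k\<bar>" if "k \<in> {..<2^n}" for k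
  proof -
    have "\<bar>2 * X k + H k\<bar> \<le> 3 * e"
      using assms[of k] that unfolding X_def H_def by simp
    then have "\<bar>2 * X k + H k\<bar> * \<bar>H k\<bar> \<le> 3 * e * \<bar>H k\<bar>"
      by (rule mult_right_mono) simp
    then show ?thesis
      by (simp add: abs_mult mult.commute[of "\<bar>H k\<bar>"])
  qed
  have "dyadic_variation T n (\<lambda>s. x s + h s) u - dyadic_variation T n x u
      = (\<Sum>k\<in>K. H k * (2 * X k + H k))"
    unfolding dyadic_variation_def K_def X_def H_def sum_subtractf[symmetric]
    by (intro sum.cong) (auto simp: power2_eq_square algebra_simps)
  also have "\<bar>\<dots>\<bar> \<le> (\<Sum>k\<in>K. \<bar>H k * (2 * X k + H k)\<bar>)"
    by (rule sum_abs)
  \<comment> \<open>Enlarging \<open>K\<close> to all indices removes the dependence on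
    \<open>u\<close>; the Lipschitz estimate needs a bound uniform in \<open>u\<close>.\<close>
  also have "\<dots> \<le> (\<Sum>k<2^n. \<bar>H k * (2 * X k + H k)\<bar>)"
    using K by (intro sum_mono2) auto
  also have "\<dots> \<le> (\<Sum>k<2^n. 3 * e * \<bar>H k\<bar>)"
    by (intro sum_mono term_le)
  finally show ?thesis
    by (simp add: H_def sum_distrib_left)
qed

text \<open>The two infima are compared candidate by candidate at the same \<open>u\<close>, where
  the penalty \<open>\<Lambda> * (t - u)\<close> is common to both. Nonnegativity of
  \<open>a\<close> bounds its candidates below, so that its real infimum lies below each of
  them.\<close>

lemma regularization_le_add:
  assumes "\<Lambda> \<ge> 0" "t \<ge> 0" "\<And>u. u \<in> {0..t} \<Longrightarrow> 0 \<le> a u"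
    and "\<And>u. u \<in> {0..t} \<Longrightarrow> a u \<le> b u + d"
  shows "regularization \<Lambda> a t \<le> regularization \<Lambda> b t + d"
proof -
  have bdd: "bdd_below ((\<lambda>u. a u + \<Lambda> * (t - u)) ` {0..t})"
    using assms by (intro bdd_belowI2[of _ 0]) (auto intro!: add_nonneg_nonneg)
  have "regularization \<Lambda> a t - d \<le> b u + \<Lambda> * (t - u)" if "u \<in> {0..t}" for u
    using cINF_lower[OF bdd that] assms(4)[OF that] unfolding regularization_def by linarith
  then have "regularization \<Lambda> a t - d \<le> regularization \<Lambda> b t"
    unfolding regularization_def[of \<Lambda> b] using assms(2) by (intro cINF_greatest) auto
  then show ?thesis by simp
qed

lemma regularization_lipschitz:
  assumes "\<Lambda> \<ge> 0" "t \<ge> 0"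
    and "\<And>u. u \<in> {0..t} \<Longrightarrow> 0 \<le> a u" "\<And>u. u \<in> {0..t} \<Longrightarrow> 0 \<le> b u"
    and "\<And>u. u \<in> {0..t} \<Longrightarrow> \<bar>a u - b u\<bar> \<le> d"
  shows "\<bar>regularization \<Lambda> a t - regularization \<Lambda> b t\<bar> \<le> d"
proof -
  have "a u \<le> b u + d" "b u \<le> a u + d" if "u \<in> {0..t}" for u
    using assms(5)[OF that] by linarith+
  then have "regularization \<Lambda> a t \<le> regularization \<Lambda> b t + d"
    and "regularization \<Lambda> b t \<le> regularization \<Lambda> a t + d"
    using assms(1-4) by (blast intro: regularization_le_add)+
  then show ?thesis by linarith
qed

lemma approx_bracket_diff_tendsto_0:
  assumes T: "T > 0" and \<Lambda>: "\<Lambda> \<ge> 0" and t: "t \<ge> 0"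
    and x: "continuous_on {0..T} x"
    and h: "continuous_on {0..T} h" "finite_variation_on 0 T h"
  shows "(\<lambda>n. approx_bracket T \<Lambda> n (\<lambda>s. x s + h s) t - approx_bracket T \<Lambda> n x t) \<longlonglongrightarrow> 0"
proof (rule tendstoI)
  fix e :: real assume e: "e > 0"
  obtain C where C: "C > 0"
    "\<And>n. (\<Sum>k<2^n. \<bar>h (dyadic T n (Suc k)) - h (dyadic T n k)\<bar>) \<le> C"
    using finite_variation_on_dyadic_bound[OF T h(2)] by blast
  \<comment> \<open>This choice gives \<open>3 * d * C = e / 2\<close>, which leaves room for the
    strict inequality.\<close>
  define d where "d = e / (6 * C)"
  have d: "d > 0" "3 * d * C < e"
    using e C(1) by (simp_all add: d_def)
  show "\<forall>\<^sub>F n in sequentially.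
      dist (approx_bracket T \<Lambda> n (\<lambda>s. x s + h s) t - approx_bracket T \<Lambda> n x t) 0 < e"
    using dyadic_increment_eventually_small[OF T x d(1)]
      dyadic_increment_eventually_small[OF T h(1) d(1)]
  proof eventually_elim
    case (elim n)
    have "\<bar>dyadic_variation T n (\<lambda>s. x s + h s) u - dyadic_variation T n x u\<bar> \<le> 3 * d * C" for u
    proof (rule order_trans[OF dyadic_variation_diff_le])
      show "3 * d * (\<Sum>k<2^n. \<bar>h (dyadic T n (Suc k)) - h (dyadic T n k)\<bar>) \<le> 3 * d * C"
        using C(2) d(1) by (intro mult_left_mono) auto
    qed (use elim in auto)
    then have "\<bar>approx_bracket T \<Lambda> n (\<lambda>s. x s + h s) t - approx_bracket T \<Lambda> n x t\<bar> \<le> 3 * d * C"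
      unfolding approx_bracket_def using \<Lambda> t dyadic_variation_nonneg
      by (intro regularization_lipschitz) auto
    then show ?case
      using d(2) by (simp add: dist_real_def)
  qed
qed

theorem proposition6p1:
  fixes T \<Lambda> :: real and x h :: "real \<Rightarrow> real"
  assumes "T > 0" and "\<Lambda> > 0"
    and "x \<in> path_space T"
    and "continuous_on {0..T} h" and "finite_variation_on 0 T h" and "h 0 = 0"
  shows "\<forall>t\<in>{0..T}. bracket T \<Lambda> (\<lambda>s. x s + h s) t = bracket T \<Lambda> x t"
proof
  fix t assume t: "t \<in> {0..T}"
  let ?q = "\<lambda>n. approx_bracket T \<Lambda> n x t"
  let ?p = "\<lambda>n. approx_bracket T \<Lambda> n (\<lambda>s. x s + h s) t"
  have "(\<lambda>n. ?p n - ?q n) \<longlonglongrightarrow> 0"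
    using assms t by (intro approx_bracket_diff_tendsto_0) (auto simp: path_space_def)
  then have "(\<lambda>n. ereal (?p n - ?q n)) \<longlonglongrightarrow> 0"
    by (simp add: zero_ereal_def)
  \<comment> \<open>The limit superior is only subadditive in general, but it is additive when one
    summand converges to a finite limit. The sum on the left is \<open>?p n\<close>.\<close>
  then have "limsup (\<lambda>n. ereal (?p n - ?q n) + ereal (?q n)) = 0 + limsup (\<lambda>n. ereal (?q n))"
    by (rule ereal_limsup_lim_add) simp
  then show "bracket T \<Lambda> (\<lambda>s. x s + h s) t = bracket T \<Lambda> x t"
    by (simp add: bracket_def)
qed

end
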